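(* In the setting fixed in the context, suppose that $f$ is convex. Let $D=\sqrt{\sup_{x,y\in P}D_\phi(x,y)}$ and let $\nu\in(0,1]$. Consider the iterates $(x_t)$ of the Frank--Wolfe algorithm started at $x_0\in P$ with the open loop step-size $\gamma_t=\frac{2}{2+t}$. Then for all $t\ge1$, $$f(x_t)-f^*\le\frac{2^{1+\nu}LD^2}{(t+2)^\nu},$$ and hence for any accuracy $\epsilon>0$ we have $f(x_t)-f^*\le\epsilon$ for all $t\ge(2^{1+\nu}LD^2/\epsilon)^{1/\nu}$.
   Context: Setting. $C\subset\mathbb R^n$ is a nonempty open convex set. A kernel generating distance associated with $C$ is a proper lower semicontinuous convex function $\phi:\mathbb R^n\to(-\infty,+\infty]$ with $\operatorname{dom}\phi\subset\operatorname{cl}C$, $\operatorname{dom}\partial\phi=C$, and $\phi$ of class $C^1$ on $\operatorname{int}\operatorname{dom}\phi= C$. The Bregman distance is $D_\phi(x,y)=\phi(x)-\phi(y)-\langle\nabla\phi(y),x-y\rangle$. Standing assumptions: (i) $\phi$ is a kernel generating distance associated with $C$, $\operatorname{cl}C=\operatorname{cl}\operatorname{dom}\phi$, $\phi$ is strictly convex on $C$, and $\nu>0$ satisfies $D_\phi((1-\gamma)x+\gamma y,x)\le\gamma^{1+\nu}D_\phi(y,x)$ for all $x,y\in C$, $\gamma\in[0,1]$; (ii) $f:\mathbb R^n\to(-\infty,+\infty]$ is proper, lower semicontinuous, $\operatorname{dom}\phi\subset\operatorname{dom}f$, and $f$ is $C^1$ on $C$; (iii) the pair $(f,\phi)$ is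 $L$-smooth adaptable on $P$: $L>0$ and both $L\phi-f$ and $L\phi+f$ are convex on $P$; (iv) $P\subset\mathbb R^n$ is a nonempty compact convex set with $P\subset C$. Write $f^*=\min_{x\in P}f(x)$. Frank--Wolfe algorithm: given $x_0\in P$, for $t=0,1,\dots$ pick $v_t\in\operatorname{argmin}_{v\in P}\langle\nabla f(x_t),v\rangle$, a step-size $\gamma_t\in[0,1]$, and set $x_{t+1}=(1-\gamma_t)x_t+\gamma_tv_t$. *)

theory Defs
  imports "HOL-Analysis.Analysis"
begin

section \<open>Extended real-valued functions\<close>

definition edom :: "('a \<Rightarrow> ereal) \<Rightarrow> 'a set" where
  "edom h = {x. h x < \<infinity>}"

definition proper_fun :: "('a \<Rightarrow> ereal) \<Rightarrow> bool" where
  "proper_fun h \<longleftrightarrow> (\<forall>x. h x \<noteq> -\<infinity>) \<and> edom h \<noteq> {}"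

text \<open>The filter \<^term>\<open>at x\<close> is punctured, which does not affect this notion.\<close>

definition lsc_fun :: "('a::topological_space \<Rightarrow> ereal) \<Rightarrow> bool" where
  "lsc_fun h \<longleftrightarrow> (\<forall>x. h x \<le> Liminf (at x) h)"

text \<open>Convexity through the epigraph, which avoids sums of opposite infinities.
  The library constant \<^const>\<open>epigraph\<close> only covers real-valued functions.\<close>

definition convex_fun :: "('a::real_vector \<Rightarrow> ereal) \<Rightarrow> bool" where
  "convex_fun h \<longleftrightarrow> convex {(x, r::real). h x \<le> ereal r}"

definition strictly_convex_on :: "'a::real_vector set \<Rightarrow> ('a \<Rightarrow> ereal) \<Rightarrow> bool" where
  "strictly_convex_on S h \<longleftrightarrow>
     (\<forall>x\<in>S. \<forall>y\<in>S. \<forall>u::real. x \<noteq> y \<longrightarrow> 0 < u \<longrightarrow> u < 1 \<longrightarrow>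
        h ((1 - u) *\<^sub>R x + u *\<^sub>R y) < ereal (1 - u) * h x + ereal u * h y)"

definition subdifferential :: "('a::real_inner \<Rightarrow> ereal) \<Rightarrow> 'a \<Rightarrow> 'a set" where
  "subdifferential h x = {g. x \<in> edom h \<and> (\<forall>y. h x + ereal (g \<bullet> (y - x)) \<le> h y)}"

text \<open>The gradient is only meaningful at points near which \<open>h\<close> is finite and at which it is
  differentiable.\<close>

definition grad :: "('a::real_inner \<Rightarrow> ereal) \<Rightarrow> 'a \<Rightarrow> 'a" where
  "grad h x = (THE g. GDERIV (\<lambda>z. real_of_ereal (h z)) x :> g)"

definition C1_on :: "'a::real_inner set \<Rightarrow> ('a \<Rightarrow> ereal) \<Rightarrow> bool" where
  "C1_on S h \<longleftrightarrow>
     (\<forall>x\<in>S. \<bar>h x\<bar> \<noteq> \<infinity>) \<and>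
     (\<forall>x\<in>S. \<exists>g. GDERIV (\<lambda>z. real_of_ereal (h z)) x :> g) \<and>
     continuous_on S (grad h)"

section \<open>Bregman distances and relative smoothness\<close>

definition kernel_generating_distance :: "'a::real_inner set \<Rightarrow> ('a \<Rightarrow> ereal) \<Rightarrow> bool" where
  "kernel_generating_distance C \<phi> \<longleftrightarrow>
     proper_fun \<phi> \<and> lsc_fun \<phi> \<and> convex_fun \<phi> \<and>
     edom \<phi> \<subseteq> closure C \<and>
     {x. subdifferential \<phi> x \<noteq> {}} = C \<and>
     interior (edom \<phi>) = C \<and>
     C1_on (interior (edom \<phi>)) \<phi>"

definition bregman :: "('a::real_inner \<Rightarrow> ereal) \<Rightarrow> 'a \<Rightarrow> 'a \<Rightarrow> ereal" where
  "bregman \<phi> x y = \<phi> x - \<phi> y - ereal (grad \<phi> y \<bullet> (x - y))"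

text \<open>Used only for sets \<open>P\<close> on which both functions are finite.\<close>

definition smooth_adaptable ::
    "real \<Rightarrow> 'a::real_vector set \<Rightarrow> ('a \<Rightarrow> ereal) \<Rightarrow> ('a \<Rightarrow> ereal) \<Rightarrow> bool" where
  "smooth_adaptable L P f \<phi> \<longleftrightarrow>
     L > 0 \<and>
     convex_on P (\<lambda>x. L * real_of_ereal (\<phi> x) - real_of_ereal (f x)) \<and>
     convex_on P (\<lambda>x. L * real_of_ereal (\<phi> x) + real_of_ereal (f x))"

section \<open>The Frank--Wolfe algorithm\<close>

text \<open>The choice of \<open>v t\<close> among the minimizers is left open, so the algorithm is a relation.\<close>

definition frank_wolfe ::
    "'a::real_inner set \<Rightarrow> ('a \<Rightarrow> ereal) \<Rightarrow> (nat \<Rightarrow> real) \<Rightarrow> (nat \<Rightarrow> 'a) \<Rightarrow> (nat \<Rightarrow> 'a) \<Rightarrow> bool" where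
  "frank_wolfe P f \<gamma> v x \<longleftrightarrow>
     x 0 \<in> P \<and>
     (\<forall>t. is_arg_min (\<lambda>w. grad f (x t) \<bullet> w) (\<lambda>w. w \<in> P) (v t) \<and>
          0 \<le> \<gamma> t \<and> \<gamma> t \<le> 1 \<and>
          x (Suc t) = (1 - \<gamma> t) *\<^sub>R x t + \<gamma> t *\<^sub>R v t)"

end

theory Submission
  imports Defs
begin

text \<open>Convexity of \<open>L\<phi> - f\<close> gives the descent inequality
  \<open>f(y) \<le> f(x) + \<langle>\<nabla>f(x), y - x\<rangle> + L D\<^sub>\<phi>(y, x)\<close>. Applied to one step and combined with the scaling
  property of \<open>D\<^sub>\<phi>\<close>, the choice of \<open>v\<^sub>t\<close> and the convexity of \<open>f\<close>, it bounds the gap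
  \<open>h\<^sub>t = f(x\<^sub>t) - f\<^sup>*\<close> by \<open>h\<^sub>t\<^sub>+\<^sub>1 \<le> (1 - \<gamma>\<^sub>t) h\<^sub>t + L D\<^sup>2 \<gamma>\<^sub>t\<^sup>1\<^sup>+\<^sup>\<nu>\<close>, and induction on \<open>t\<close> yields the
  rate. In the complexity bound \<open>t = 0\<close> is admissible only if \<open>D = 0\<close>; then strict convexity of
  \<open>\<phi>\<close> makes \<open>P\<close> a singleton.\<close>

section \<open>Gradients and first-order convexity inequalities\<close>

lemma C1_on_GDERIV:
  assumes "C1_on S h" "x \<in> S"
  shows "GDERIV (\<lambda>z. real_of_ereal (h z)) x :> grad h x"
proof -
  obtain g where g: "GDERIV (\<lambda>z. real_of_ereal (h z)) x :> g"
    using assms by (auto simp: C1_on_def)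
  \<comment> \<open>\<open>grad\<close> is a definite description, so uniqueness is needed besides
    the existence that \<open>C1_on\<close> provides.\<close>
  have "g' = g" if "GDERIV (\<lambda>z. real_of_ereal (h z)) x :> g'" for g'
  proof -
    have "(\<lambda>u. u \<bullet> g') = (\<lambda>u. u \<bullet> g)"
      using that g by (auto simp: gderiv_def dest: has_derivative_unique)
    then show ?thesis
      by (metis inner_commute vector_eq_rdot)
  qed
  with g show ?thesis
    unfolding grad_def by (rule theI)
qed

lemma C1_on_continuous_on:
  assumes "C1_on S h"
  shows "continuous_on S (\<lambda>z. real_of_ereal (h z))"
  using C1_on_GDERIV[OF assms]
  by (meson continuous_at_imp_continuous_on gderiv_def has_derivative_continuous)

lemma convex_fun_imp_convex_on:
  assumes "convex_fun h" "convex S" "\<And>x. x \<in> S \<Longrightarrow> \<bar>h x\<bar> \<noteq> \<infinity>"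
  shows "convex_on S (\<lambda>x. real_of_ereal (h x))"
proof (rule convex_onI)
  fix t :: real and x y
  assume t: "0 < t" "t < 1" and xy: "x \<in> S" "y \<in> S"
  let ?h = "\<lambda>x. real_of_ereal (h x)" and ?z = "(1 - t) *\<^sub>R x + t *\<^sub>R y"
  have "?z \<in> S"
    using assms(2) t xy by (simp add: convex_alt)
  have fin: "h u = ereal (?h u)" if "u \<in> S" for u
    using assms(3)[OF that] by (simp add: ereal_real)
  \<comment> \<open>Finiteness puts both graph points into the epigraph, whose convexity then yields
    the inequality.\<close>
  have "(1 - t) *\<^sub>R (x, ?h x) + t *\<^sub>R (y, ?h y) \<in> {(x, r::real). h x \<le> ereal r}"
    using assms(1) t xy fin unfolding convex_fun_def convex_alt by simp
  then have "h ?z \<le> ereal ((1 - t) * ?h x + t * ?h y)"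
    by simp
  with fin[OF \<open>?z \<in> S\<close>] show "?h ?z \<le> (1 - t) * ?h x + t * ?h y"
    by (metis ereal_less_eq(3))
qed (fact assms(2))

text \<open>Along the segment from \<open>x\<close> to \<open>y\<close> the difference quotients are
  at most \<open>g y - g x\<close>, and they tend to the directional derivative from the right. Only
  points of the segment are tested, so \<open>S\<close> may have empty interior.\<close>

lemma convex_on_above_tangent_GDERIV:
  fixes g :: "'a::real_inner \<Rightarrow> real"
  assumes "convex_on S g" "x \<in> S" "y \<in> S" "GDERIV g x :> d"
  shows "g x + d \<bullet> (y - x) \<le> g y"
proof -
  let ?q = "\<lambda>s. g (x + s *\<^sub>R (y - x))"
  have "((\<lambda>s. x + s *\<^sub>R (y - x)) has_derivative (\<lambda>s. s *\<^sub>R (y - x))) (at 0)"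
    by (auto intro!: derivative_eq_intros)
  moreover have "(g has_derivative (\<lambda>u. u \<bullet> d)) (at (x + 0 *\<^sub>R (y - x)))"
    using assms(4) by (simp add: gderiv_def)
  ultimately have "(?q has_derivative (\<lambda>s. (s *\<^sub>R (y - x)) \<bullet> d)) (at 0)"
    by (rule has_derivative_compose)
  then have "(?q has_real_derivative d \<bullet> (y - x)) (at 0)"
    by (simp add: has_field_derivative_def inner_commute mult_commute_abs)
  then have "((\<lambda>s. (?q s - ?q 0) / s) \<longlongrightarrow> d \<bullet> (y - x)) (at_right 0)"
    by (simp add: has_field_derivative_iff filterlim_at_split)
  moreover have "\<forall>\<^sub>F s in at_right 0. (?q s - ?q 0) / s \<le> g y - g x"
    using eventually_at_right_real[OF zero_less_one]
  proof eventually_elim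
    case (elim s)
    have "x + s *\<^sub>R (y - x) = (1 - s) *\<^sub>R x + s *\<^sub>R y"
      by (simp add: algebra_simps)
    then have "?q s \<le> (1 - s) * g x + s * g y"
      using convex_onD[OF assms(1), of s x y] elim assms(2,3) by simp
    with elim show ?case
      by (simp add: field_simps)
  qed
  ultimately have "d \<bullet> (y - x) \<le> g y - g x"
    by (rule tendsto_upperbound) simp
  then show ?thesis
    by simp
qed

section \<open>Bregman distances and the descent inequality\<close>

lemma bregman_real:
  assumes "\<bar>\<phi> x\<bar> \<noteq> \<infinity>" "\<bar>\<phi> y\<bar> \<noteq> \<infinity>"
  shows "bregman \<phi> x y
    = ereal (real_of_ereal (\<phi> x) - real_of_ereal (\<phi> y) - grad \<phi> y \<bullet> (x - y))"
  using assms unfolding bregman_def by (cases "\<phi> x"; cases "\<phi> y") auto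

text \<open>This is the tangent inequality at \<open>x\<close> for the convex function L\<phi> - f,
  rearranged. Convexity is used on \<open>P\<close> only, differentiability comes from
  \<open>C\<close>.\<close>

lemma smooth_adaptable_descent:
  assumes "C1_on C \<phi>" "C1_on C f" "P \<subseteq> C" "smooth_adaptable L P f \<phi>" "x \<in> P" "y \<in> P"
  shows "real_of_ereal (f y)
    \<le> real_of_ereal (f x) + grad f x \<bullet> (y - x) + L * real_of_ereal (bregman \<phi> y x)"
proof -
  have "x \<in> C" "y \<in> C"
    using assms by auto
  note d\<phi> = C1_on_GDERIV[OF assms(1) \<open>x \<in> C\<close>] and df = C1_on_GDERIV[OF assms(2) \<open>x \<in> C\<close>]
  have "GDERIV (\<lambda>z. L * real_of_ereal (\<phi> z) - real_of_ereal (f z)) x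
      :> L *\<^sub>R grad \<phi> x - grad f x"
    using d\<phi> df unfolding gderiv_def
    by (auto intro!: derivative_eq_intros simp: inner_diff_right)
  from convex_on_above_tangent_GDERIV[OF _ assms(5,6) this] assms(4)
  have "L * real_of_ereal (\<phi> x) - real_of_ereal (f x) + (L *\<^sub>R grad \<phi> x - grad f x) \<bullet> (y - x)
      \<le> L * real_of_ereal (\<phi> y) - real_of_ereal (f y)"
    by (simp add: smooth_adaptable_def)
  moreover have "real_of_ereal (bregman \<phi> y x)
      = real_of_ereal (\<phi> y) - real_of_ereal (\<phi> x) - grad \<phi> x \<bullet> (y - x)"
    using assms(1) \<open>x \<in> C\<close> \<open>y \<in> C\<close> by (simp add: bregman_real C1_on_def)
  ultimately show ?thesis
    by (simp add: inner_diff_left right_diff_distrib)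
qed

text \<open>\<open>D\<close> is defined through \<open>real_of_ereal\<close>, which sends infinity
  to 0; finiteness makes its square the true supremum. The Bregman distance is jointly continuous on
  the compact set \<open>P \<times> P\<close> and vanishes on the diagonal.\<close>

lemma bregman_SUP_finite:
  fixes P :: "'a::real_inner set"
  assumes "C1_on C \<phi>" "P \<subseteq> C" "compact P" "P \<noteq> {}"
  obtains s where "(SUP (y, z)\<in>P \<times> P. bregman \<phi> y z) = ereal s" "0 \<le> s"
proof -
  let ?b = "\<lambda>p. real_of_ereal (\<phi> (fst p)) - real_of_ereal (\<phi> (snd p))
    - grad \<phi> (snd p) \<bullet> (fst p - snd p)"
  let ?S = "SUP (y, z)\<in>P \<times> P. bregman \<phi> y z"
  have b: "bregman \<phi> y z = ereal (?b (y, z))" if "y \<in> P" "z \<in> P" for y z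
    using assms(1,2) that by (simp add: bregman_real C1_on_def subset_iff)
  have \<Phi>: "continuous_on P (\<lambda>z. real_of_ereal (\<phi> z))" and G: "continuous_on P (grad \<phi>)"
    using C1_on_continuous_on[OF assms(1)] assms(1,2)
    by (auto simp: C1_on_def intro: continuous_on_subset)
  have pr: "continuous_on (P \<times> P) fst" "continuous_on (P \<times> P) snd"
    "fst ` (P \<times> P) \<subseteq> P" "snd ` (P \<times> P) \<subseteq> P"
    by (auto intro: continuous_on_fst continuous_on_snd)
  have "continuous_on (P \<times> P) ?b"
    by (intro continuous_on_diff continuous_on_inner pr
        continuous_on_compose2[OF \<Phi> pr(1,3)] continuous_on_compose2[OF \<Phi> pr(2,4)]
        continuous_on_compose2[OF G pr(2,4)])
  then have "compact (?b ` (P \<times> P))"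
    using assms(3) by (intro compact_continuous_image compact_Times)
  then have "bdd_above (?b ` (P \<times> P))"
    by (intro bounded_imp_bdd_above compact_imp_bounded)
  then obtain B where "\<forall>p\<in>P \<times> P. ?b p \<le> B"
    unfolding bdd_above_def by blast
  then have "bregman \<phi> y z \<le> ereal B" if "y \<in> P" "z \<in> P" for y z
    unfolding b[OF that] using that by (simp only: ereal_less_eq) blast
  then have "?S \<le> ereal B"
    by (intro SUP_least) auto
  moreover obtain a where "a \<in> P"
    using assms(4) by auto
  then have "0 \<le> ?S"
    by (intro SUP_upper2[of "(a, a)"]) (auto simp: b)
  ultimately show ?thesis
    by (cases ?S) (use that in auto)
qed

text \<open>At the midpoint of \<open>y\<close> and \<open>z\<close>, the tangent at
  \<open>z\<close> lies below \<phi> and \<phi> lies strictly below the chord; doubling the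
  difference gives the claim.\<close>

lemma bregman_pos:
  assumes "convex_on C (\<lambda>x. real_of_ereal (\<phi> x))" "C1_on C \<phi>" "strictly_convex_on C \<phi>"
    and "y \<in> C" "z \<in> C" "y \<noteq> z"
  shows "0 < bregman \<phi> y z"
proof -
  let ?\<Phi> = "\<lambda>x. real_of_ereal (\<phi> x)" and ?m = "(1 - 1/2) *\<^sub>R y + (1/2) *\<^sub>R z"
  have m: "?m \<in> C"
    using assms(1,4,5) by (intro convexD_alt) (auto dest: convex_on_imp_convex)
  have fin: "\<bar>\<phi> u\<bar> \<noteq> \<infinity>" if "u \<in> C" for u
    using assms(2) that by (simp add: C1_on_def)
  have "\<phi> ?m < ereal (1 - 1/2) * \<phi> y + ereal (1/2) * \<phi> z"
    using assms(3-6) unfolding strictly_convex_on_def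
    by (metis half_gt_zero_iff less_numeral_extra(1) field_sum_of_halves less_add_same_cancel1)
  then have "?\<Phi> ?m < (1 - 1/2) * ?\<Phi> y + 1/2 * ?\<Phi> z"
    using fin[OF m] fin[OF assms(4)] fin[OF assms(5)]
    by (cases "\<phi> ?m"; cases "\<phi> y"; cases "\<phi> z") simp_all
  moreover have "?\<Phi> z + grad \<phi> z \<bullet> (?m - z) \<le> ?\<Phi> ?m"
    using assms m by (intro convex_on_above_tangent_GDERIV[OF assms(1)] C1_on_GDERIV) auto
  moreover have "?m - z = (1/2) *\<^sub>R (y - z)"
    by (simp add: algebra_simps flip: scaleR_add_left)
  ultimately have "0 < ?\<Phi> y - ?\<Phi> z - grad \<phi> z \<bullet> (y - z)"
    by simp
  then show ?thesis
    using assms(2,4,5) by (simp add: bregman_real C1_on_def)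
qed

section \<open>The recursion for the open loop step-size\<close>

lemma open_loop_step_aux:
  fixes a \<nu> :: real
  assumes "0 < a" "0 \<le> \<nu>" "\<nu> \<le> 1"
  shows "a * (a + 2) powr \<nu> \<le> (a + 1) powr (1 + \<nu>)"
proof -
  \<comment> \<open>The base is at least 1 and \<nu> is at most 1, so the power is at most the base;
    what remains is a (a + 2) \<le> (a + 1)^2.\<close>
  have "((a + 2) / (a + 1)) powr \<nu> \<le> ((a + 2) / (a + 1)) powr 1"
    using assms by (intro powr_mono) auto
  also have "\<dots> \<le> (a + 1) / a"
    using assms by (simp add: field_simps)
  finally show ?thesis
    using assms by (simp add: powr_divide powr_add field_simps)
qed

text \<open>The induction starts at 1: the first step-size is 1, which removes \<open>h 0\<close>
  from the recursion, so no bound on the initial gap is required.\<close>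

lemma open_loop_recursion_bound:
  fixes h :: "nat \<Rightarrow> real"
  assumes rec: "\<And>t. h (Suc t) \<le> (1 - 2 / (2 + real t)) * h t + M * (2 / (2 + real t)) powr (1 + \<nu>)"
    and "0 \<le> M" "0 \<le> \<nu>" "\<nu> \<le> 1" "1 \<le> t"
  shows "h t \<le> 2 powr (1 + \<nu>) * M / (real t + 2) powr \<nu>"
  using \<open>1 \<le> t\<close>
proof (induction t rule: dec_induct)
  case base
  have "3 powr \<nu> \<le> (2::real) powr (1 + \<nu>)"
    using open_loop_step_aux[of 1 \<nu>] assms by simp
  then have "M * 3 powr \<nu> \<le> M * 2 powr (1 + \<nu>)"
    using assms by (intro mult_left_mono)
  moreover have "h 1 \<le> M"
    using rec[of 0] by simp
  ultimately show ?case
    by (simp add: field_simps) (metis mult_right_mono order_trans powr_ge_zero)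
next
  case (step t)
  define K where "K = 2 powr (1 + \<nu>) * M"
  define c where "c = real t + 2"
  have c: "c > 0" "2 + real t = c" "real (Suc t) + 2 = c + 1"
    by (auto simp: c_def)
  have K: "0 \<le> K"
    using assms by (simp add: K_def)
  have "h (Suc t) \<le> (1 - 2 / c) * (K / c powr \<nu>) + M * (2 / c) powr (1 + \<nu>)"
  proof -
    have "(1 - 2 / c) * h t \<le> (1 - 2 / c) * (K / c powr \<nu>)"
      using step.IH by (intro mult_left_mono) (auto simp: K_def c_def field_simps)
    with rec[of t] show ?thesis
      unfolding c(2) by linarith
  qed
  \<comment> \<open>The constant \<open>K\<close> is chosen so that the second summand is
    \<open>K / c powr (1 + \<nu>)\<close>; the first is
    \<open>K * (c - 2) / c powr (1 + \<nu>)\<close>.\<close>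
  also have "\<dots> = K * ((c - 1) / c powr (1 + \<nu>))"
    using c(1) by (simp add: K_def powr_divide powr_add field_simps)
  also have "\<dots> \<le> K * (1 / (c + 1) powr \<nu>)"
    using open_loop_step_aux[of "c - 1" \<nu>] assms c K
    by (intro mult_left_mono) (auto simp: c_def field_simps)
  finally show ?case
    unfolding c(3) by (simp add: K_def)
qed

section \<open>The convergence rate and the complexity bound\<close>

theorem theoremD2:
  fixes C P :: "(real ^ 'n) set"
    and \<phi> f :: "real ^ 'n \<Rightarrow> ereal"
    and L \<nu> D :: real
    and x v :: "nat \<Rightarrow> real ^ 'n"
  assumes "open C" and "convex C" and "C \<noteq> {}"
    and "kernel_generating_distance C \<phi>"
    and "closure C = closure (edom \<phi>)"
    and "strictly_convex_on C \<phi>"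
    and "0 < \<nu>" and "\<nu> \<le> 1"
    and "\<forall>y\<in>C. \<forall>z\<in>C. \<forall>\<gamma>\<in>{0..1}.
           bregman \<phi> ((1 - \<gamma>) *\<^sub>R y + \<gamma> *\<^sub>R z) y \<le> ereal (\<gamma> powr (1 + \<nu>)) * bregman \<phi> z y"
    and "proper_fun f" and "lsc_fun f" and "edom \<phi> \<subseteq> edom f" and "C1_on C f"
    and "smooth_adaptable L P f \<phi>"
    and "P \<noteq> {}" and "compact P" and "convex P" and "P \<subseteq> C"
    and "convex_fun f"
    and "D = sqrt (real_of_ereal (SUP (y, z)\<in>P \<times> P. bregman \<phi> y z))"
    and "frank_wolfe P f (\<lambda>t. 2 / (2 + real t)) v x"
  shows "(\<forall>t\<ge>1. f (x t) - (INF y\<in>P. f y)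
             \<le> ereal (2 powr (1 + \<nu>) * L * D\<^sup>2 / (real t + 2) powr \<nu>)) \<and>
         (\<forall>\<epsilon>>0. \<forall>t. real t \<ge> (2 powr (1 + \<nu>) * L * D\<^sup>2 / \<epsilon>) powr (1 / \<nu>) \<longrightarrow>
             f (x t) - (INF y\<in>P. f y) \<le> ereal \<epsilon>)"
proof -
  let ?F = "\<lambda>z. real_of_ereal (f z)" and ?\<Phi> = "\<lambda>z. real_of_ereal (\<phi> z)"
  let ?b = "\<lambda>y z. real_of_ereal (bregman \<phi> y z)"
  have \<phi>C1: "C1_on C \<phi>" and "convex_fun \<phi>"
    using assms(4) by (auto simp: kernel_generating_distance_def)
  then have \<Phi>conv: "convex_on C ?\<Phi>"
    using assms(2) by (intro convex_fun_imp_convex_on) (auto simp: C1_on_def)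
  have Fconv: "convex_on C ?F"
    using assms(2,13,19) by (intro convex_fun_imp_convex_on) (auto simp: C1_on_def)
  have L: "0 < L"
    using assms(14) by (simp add: smooth_adaptable_def)
  have f_fin: "f z = ereal (?F z)" if "z \<in> P" for z
    using assms(13,18) that by (simp add: C1_on_def ereal_real subset_iff)
  have b_fin: "bregman \<phi> y z = ereal (?b y z)" if "y \<in> C" "z \<in> C" for y z
    using \<phi>C1 that by (simp add: bregman_real C1_on_def)

  obtain s where s: "(SUP (y, z)\<in>P \<times> P. bregman \<phi> y z) = ereal s" "0 \<le> s"
    using bregman_SUP_finite[OF \<phi>C1 assms(18,16,15)] .
  then have D: "D\<^sup>2 = s"
    using assms(20) by simp
  have b_le: "?b y z \<le> s" if "y \<in> P" "z \<in> P" for y z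
  proof -
    have "bregman \<phi> y z \<le> ereal s"
      unfolding s(1)[symmetric] using that by (intro SUP_upper2[of "(y, z)"]) auto
    then show ?thesis
      using b_fin[of y z] that assms(18) by (metis ereal_less_eq(3) subsetD)
  qed

  have "continuous_on P ?F"
    using C1_on_continuous_on[OF assms(13)] assms(18) by (rule continuous_on_subset)
  then obtain w where w: "w \<in> P" "\<And>y. y \<in> P \<Longrightarrow> ?F w \<le> ?F y"
    using continuous_attains_inf[OF assms(16,15)] by blast
  \<comment> \<open>The infimum is attained at \<open>w\<close>, so the gap becomes a difference of
    reals.\<close>
  have INF: "(INF y\<in>P. f y) = ereal (?F w)"
  proof (rule antisym)
    show "(INF y\<in>P. f y) \<le> ereal (?F w)"
      using w(1) f_fin by (metis INF_lower)
    show "ereal (?F w) \<le> (INF y\<in>P. f y)"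
      using w by (intro INF_greatest) (metis ereal_less_eq(3) f_fin)
  qed

  define \<gamma> where "\<gamma> = (\<lambda>t. 2 / (2 + real t))"
  have fw: "is_arg_min (\<lambda>u. grad f (x t) \<bullet> u) (\<lambda>u. u \<in> P) (v t)" "\<gamma> t \<in> {0..1}"
    "x (Suc t) = (1 - \<gamma> t) *\<^sub>R x t + \<gamma> t *\<^sub>R v t" for t
    using assms(21) by (auto simp: frank_wolfe_def \<gamma>_def)
  have vP: "v t \<in> P" for t
    using fw(1)[of t] by (simp add: is_arg_min_def)
  have xP: "x t \<in> P" for t
  proof (induction t)
    case 0
    then show ?case
      using assms(21) by (simp add: frank_wolfe_def)
  next
    case (Suc t)
    then show ?case
      using fw(2)[of t] vP[of t] assms(17) unfolding fw(3)[of t]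
      by (intro convexD_alt) auto
  qed

  define h where "h = (\<lambda>t. ?F (x t) - ?F w)"
  have gap: "f (x t) - (INF y\<in>P. f y) = ereal (h t)" for t
    using f_fin[OF xP, of t] by (metis INF ereal_minus(1) h_def)
  have rec: "h (Suc t) \<le> (1 - \<gamma> t) * h t + L * s * \<gamma> t powr (1 + \<nu>)" for t
  proof -
    have C: "x t \<in> C" "v t \<in> C" "w \<in> C" "x (Suc t) \<in> C"
      using xP vP w assms(18) by auto
    \<comment> \<open>The scaling hypothesis, applied from \<open>x t\<close> towards
      \<open>v t\<close>, supplies the power of the step-size.\<close>
    have "bregman \<phi> (x (Suc t)) (x t) \<le> ereal (\<gamma> t powr (1 + \<nu>)) * bregman \<phi> (v t) (x t)"
      using assms(9) C fw(2)[of t] unfolding fw(3) by blast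
    then have "?b (x (Suc t)) (x t) \<le> \<gamma> t powr (1 + \<nu>) * ?b (v t) (x t)"
      using b_fin[OF C(4) C(1)] b_fin[OF C(2) C(1)] by (metis ereal_less_eq(3) times_ereal.simps(1))
    also have "\<dots> \<le> \<gamma> t powr (1 + \<nu>) * s"
      by (intro mult_left_mono b_le xP vP) simp
    finally have breg: "L * ?b (x (Suc t)) (x t) \<le> L * (\<gamma> t powr (1 + \<nu>) * s)"
      using L by simp
    \<comment> \<open>Minimality of \<open>v t\<close> permits comparison with the minimizer
      \<open>w\<close>; the gradient inequality for f at \<open>x t\<close> then brings in the
      gap.\<close>
    have "grad f (x t) \<bullet> (v t - x t) \<le> grad f (x t) \<bullet> (w - x t)"
      using fw(1)[of t] w(1) by (auto simp: is_arg_min_linorder inner_diff_right)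
    also have "\<dots> \<le> - h t"
      using convex_on_above_tangent_GDERIV[OF Fconv C(1,3) C1_on_GDERIV[OF assms(13) C(1)]]
      by (simp add: h_def)
    finally have "\<gamma> t * (grad f (x t) \<bullet> (v t - x t)) \<le> \<gamma> t * (- h t)"
      using fw(2)[of t] by (intro mult_left_mono) auto
    moreover have "x (Suc t) - x t = \<gamma> t *\<^sub>R (v t - x t)"
      by (simp add: fw(3) algebra_simps)
    then have "grad f (x t) \<bullet> (x (Suc t) - x t) = \<gamma> t * (grad f (x t) \<bullet> (v t - x t))"
      by simp
    moreover have "?F (x (Suc t))
        \<le> ?F (x t) + grad f (x t) \<bullet> (x (Suc t) - x t) + L * ?b (x (Suc t)) (x t)"
      by (rule smooth_adaptable_descent[OF \<phi>C1 assms(13,18,14) xP xP])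
    ultimately show ?thesis
      using breg by (simp add: h_def left_diff_distrib right_diff_distrib mult_ac)
  qed
  have bound: "h t \<le> 2 powr (1 + \<nu>) * L * D\<^sup>2 / (real t + 2) powr \<nu>" if "1 \<le> t" for t
    using open_loop_recursion_bound[of h "L * s" \<nu> t] rec L s(2) assms(7,8) that
    by (simp add: \<gamma>_def D mult.assoc)

  have "h t \<le> \<epsilon>"
    if \<epsilon>: "0 < \<epsilon>" and t: "(2 powr (1 + \<nu>) * L * D\<^sup>2 / \<epsilon>) powr (1 / \<nu>) \<le> real t" for \<epsilon> t
  proof (cases "t = 0")
    case True
    \<comment> \<open>The rate says nothing at \<open>t = 0\<close>. Here the threshold is at most
      0, and a \<open>powr\<close> value vanishes only for base 0; as \<open>L\<close> is positive,
      \<open>s\<close> must be 0.\<close>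
    then have "s = 0"
      using t L \<epsilon> D by simp
    \<comment> \<open>With \<open>s = 0\<close> all Bregman distances within \<open>P\<close> are at
      most 0, contradicting \<open>bregman_pos\<close> for distinct points.\<close>
    then have "w = x t"
      using bregman_pos[OF \<Phi>conv \<phi>C1 assms(6), of w "x t"] b_le[OF w(1) xP, of t]
        b_fin[of w "x t"] w(1) xP[of t] assms(18)
      by (metis ereal_less(2) leD subsetD)
    then show ?thesis
      using \<epsilon> by (simp add: h_def)
  next
    case False
    let ?A = "2 powr (1 + \<nu>) * L * D\<^sup>2"
    \<comment> \<open>Raising the threshold to the power \<nu> undoes the exponent 1/\<nu>;
      replacing t by t + 2 only enlarges the right-hand side.\<close>
    have "?A / \<epsilon> = ((?A / \<epsilon>) powr (1 / \<nu>)) powr \<nu>"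
      using L \<epsilon> assms(7) by (simp add: powr_powr)
    also have "\<dots> \<le> (real t + 2) powr \<nu>"
      using t assms(7) by (intro powr_mono2) auto
    finally have "?A / (real t + 2) powr \<nu> \<le> \<epsilon>"
      using \<epsilon> by (simp add: field_simps)
    with bound[of t] False show ?thesis
      by simp
  qed
  with bound show ?thesis
    by (simp add: gap)
qed

end
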